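(* Let $k\ge 2$ be a fixed integer, and let $a,q$ be integers such that $1\le a\le q$ and $\gcd(a,q)=1$. Let $\delta>0$ and $K>0$ be fixed real numbers. Then for any $\varepsilon>0$ there is a constant $C>0$, which may depend on $k$, $q$, $\varepsilon$, $\delta$, $K$, such that for all real $x\ge 2$ with $q\le K x^{\delta}$ one has $$\left| \sum_{\substack{n\le x\\ n\equiv a \pmod q}} D_k(n) - \frac{G_k(q)}{\varphi(q)}\,x \right| \le C\,\sqrt{q}\;x^{1/2+\varepsilon}.$$
   Context: For an integer $k\ge 1$, $d_k(n)$ denotes the Dirichlet–Piltz divisor function, i.e. the number of ordered $k$-tuples $(n_1,\dots,n_k)$ of positive integers with $n_1\cdots n_k=n$ (so $d_1=1$), and $d_k^*(n)=k^{\omega(n)}$, where $\omega(n)$ is the number of distinct prime divisors of $n$. Put $D_k(n)=d_k(n)/d_k^*(n)$; this is a multiplicative function with $D_k(p^m)=\frac1k\binom{k+m-1}{m}$ for every prime $p$ and $m\ge 1$. The sum runs over positive integers $n$, and $\varphi$ is Euler's totient function. Further, $$A_k=\prod_{p}\Bigl(1-\frac1p\Bigr)\Bigl(1-\frac1k+\frac1k\Bigl(1-\frac1p\Bigr)^{-k}\Bigr),\qquad G_k(q)=A_k\prod_{p\mid q}\frac{k}{k-1+(1-1/p)^{-k}},$$ where the first product is over all primes $p$ and the second over the primes dividing $q$. *)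

theory Defs
  imports "HOL-Analysis.Analysis" "HOL-Number_Theory.Number_Theory"
begin

(* Ordered k-tuples of positive integers are lists of length k. *)
definition piltz_divisor :: "nat \<Rightarrow> nat \<Rightarrow> nat" where
  "piltz_divisor k n =
     card {ns :: nat list. length ns = k \<and> (\<forall>m\<in>set ns. 0 < m) \<and> prod_list ns = n}"

definition distinct_prime_count :: "nat \<Rightarrow> nat" where
  "distinct_prime_count n = card (prime_factors n)"

definition piltz_divisor_star :: "nat \<Rightarrow> nat \<Rightarrow> nat" where
  "piltz_divisor_star k n = k ^ distinct_prime_count n"

definition D_ratio :: "nat \<Rightarrow> nat \<Rightarrow> real" where
  "D_ratio k n = real (piltz_divisor k n) / real (piltz_divisor_star k n)"

(* The product over all primes is written as a product over all natural numbers whose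
   non-prime factors are 1. *)
definition A_const :: "nat \<Rightarrow> real" where
  "A_const k =
     (\<Prod>p. if prime (p::nat)
           then (1 - 1 / real p) * (1 - 1 / real k + 1 / real k * (1 - 1 / real p) powi (- int k))
           else 1)"

definition G_const :: "nat \<Rightarrow> nat \<Rightarrow> real" where
  "G_const k q =
     A_const k *
       (\<Prod>p\<in>prime_factors q. real k / (real k - 1 + (1 - 1 / real p) powi (- int k)))"

end

theory Submission
  imports Defs
begin

text \<open>
  Write \<open>D = D_ratio k\<close> as a Dirichlet convolution of the constant function 1 with a function \<open>h\<close>
  (called \<open>D_moebius k\<close> below; it is the convolution of \<open>D\<close> with the Moebius function). Since \<open>D\<close>
  takes the value 1 at primes as well as at 1, \<open>h\<close> vanishes at primes, so \<open>h\<close> lives on the squareful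
  numbers; and since \<open>D(p ^ m)\<close> grows polynomially in \<open>m\<close>, the series \<open>\<Sum> h(d) / d^s\<close> converges for
  every \<open>s > 1/2\<close> (\<open>summable_D_moebius_powr\<close>). Moreover \<open>D(p ^ m)\<close> is nondecreasing in \<open>m\<close>, so
  \<open>h\<close> is nonnegative, and no absolute values are needed in handling these series.

  Let \<open>a\<close> be coprime to \<open>q\<close>. Exchanging sums gives
  \<open>\<Sum> D(n) = \<Sum> h(d) N(d)\<close>, where \<open>n\<close> runs over the integers up to \<open>x\<close> in the progression, \<open>d\<close> over
  the integers coprime to \<open>q\<close>, and \<open>N(d)\<close> counts the multiples of \<open>d\<close> among those \<open>n\<close>. These multiples
  form one residue class modulo \<open>d * q\<close>. Hence \<open>N(d)\<close> differs from \<open>x / (d * q)\<close> by at most 1; and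
  for \<open>d > x\<close>, where \<open>N(d) = 0\<close>, by at most \<open>x / d\<close>. If \<open>1/2 < s \<le> 1\<close>, the difference is at most
  \<open>(x / d) powr s\<close>, by the first bound if \<open>d \<le> x\<close> and by the second if \<open>d > x\<close>; so the
  total error is at most \<open>x powr s * \<Sum> h(d) / d^s\<close>
  (\<open>D_ratio_progression_error\<close>). For \<open>s\<close> slightly above \<open>1/2\<close> and \<open>x \<ge> 1\<close> this
  is within the claimed error, because \<open>sqrt q \<ge> 1\<close>.

  The main term is \<open>(x / q) * \<Sum> h(d) / d\<close>, the sum being over \<open>d\<close> coprime to \<open>q\<close>. By the Euler product
  (\<open>euler_product_tendsto\<close>) the sum is the product over the primes not dividing \<open>q\<close> of
  \<open>(1 - 1/p) (1 - 1/k + (1/k) (1 - 1/p)^(-k))\<close>, a closed form that comes from the negative binomial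
  series. Comparison with the full product \<open>A_const k\<close>, together with
  \<open>totient q = q * \<Prod> (1 - 1/p)\<close>, identifies the main term with
  \<open>G_const k q / totient q * x\<close>
  (\<open>infsum_D_moebius_coprime\<close>).
\<close>

section \<open>Multiplicative functions\<close>

definition multiplicative :: "(nat \<Rightarrow> 'a::comm_semiring_1) \<Rightarrow> bool" where
  "multiplicative f \<longleftrightarrow> f 1 = 1 \<and>
     (\<forall>m n. 0 < m \<longrightarrow> 0 < n \<longrightarrow> coprime m n \<longrightarrow> f (m * n) = f m * f n)"

lemma multiplicativeD_1: "multiplicative f \<Longrightarrow> f (Suc 0) = 1"
  by (simp add: multiplicative_def)

lemma multiplicativeD_mult:
  "multiplicative f \<Longrightarrow> 0 < m \<Longrightarrow> 0 < n \<Longrightarrow> coprime m n \<Longrightarrow> f (m * n) = f m * f n"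
  by (simp add: multiplicative_def)

text \<open>
  Every divisor of a product of coprime \<open>m\<close> and \<open>n\<close> factors uniquely into a divisor of \<open>m\<close> and a
  divisor of \<open>n\<close>, namely its greatest common divisors with \<open>m\<close> and with \<open>n\<close>.
\<close>
lemma multiplicative_divisor_sum:
  assumes "multiplicative f"
  shows "multiplicative (\<lambda>n. \<Sum>d | d dvd n. f d)"
  unfolding multiplicative_def
proof (intro conjI allI impI)
  show "(\<Sum>d | d dvd 1. f d) = 1"
    using assms by (simp add: multiplicative_def)
next
  fix m n :: nat
  assume pos: "0 < m" "0 < n" and cop: "coprime m n"
  have gcds: "gcd (a * b) m = a \<and> gcd (a * b) n = b" if "a dvd m" "b dvd n" for a b
  proof -
    have "coprime m b" "coprime n a"
      using cop that by (meson coprime_commute coprime_divisors dvd_refl)+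
    then show ?thesis using that
      by (simp add: gcd_mult_left_right_cancel gcd_mult_left_left_cancel gcd_nat.absorb1)
  qed
  have split: "gcd d m * gcd d n = d" if "d dvd m * n" for d
    using division_decomp[OF that] gcds by auto
  have "(\<Sum>d | d dvd m * n. f d) = (\<Sum>(a, b)\<in>{a. a dvd m} \<times> {b. b dvd n}. f (a * b))"
  proof (rule sum.reindex_bij_witness[of _ "\<lambda>(a, b). a * b" "\<lambda>d. (gcd d m, gcd d n)"], goal_cases)
    case (1 d) then show ?case using split by auto
  next
    case (2 d) then show ?case by auto
  next
    case (3 ab)
    then show ?case using gcds by auto
  next
    case (4 ab) then show ?case by (auto intro: mult_dvd_mono)
  next
    case (5 d) then show ?case using split by auto
  qed
  also have "\<dots> = (\<Sum>(a, b)\<in>{a. a dvd m} \<times> {b. b dvd n}. f a * f b)"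
  proof (rule sum.cong[OF refl], clarify)
    fix a b assume "a dvd m" "b dvd n"
    then show "f (a * b) = f a * f b"
      using assms pos cop by (intro multiplicativeD_mult) (auto intro: dvd_pos_nat coprime_divisors)
  qed
  also have "\<dots> = (\<Sum>d | d dvd m. f d) * (\<Sum>d | d dvd n. f d)"
    by (simp add: sum_product sum.cartesian_product)
  finally show "(\<Sum>d | d dvd m * n. f d) = (\<Sum>d | d dvd m. f d) * (\<Sum>d | d dvd n. f d)" .
qed

text \<open>
  Splitting off a full prime power from \<open>n\<close> leaves a smaller number coprime to it, so values at
  prime powers determine a multiplicative function.
\<close>
lemma multiplicative_eqI:
  assumes "multiplicative f" "multiplicative g"
    and prime_pow: "\<And>p m. prime p \<Longrightarrow> 0 < m \<Longrightarrow> f (p ^ m) = g (p ^ m)"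
    and "0 < n"
  shows "f n = g n"
  using \<open>0 < n\<close>
proof (induction n rule: less_induct)
  case (less n)
  show ?case
  proof (cases "n = 1")
    case True
    then show ?thesis using assms(1,2) by (simp add: multiplicative_def)
  next
    case False
    obtain p where p: "prime p" "p dvd n" using False prime_factor_nat by blast
    define m where "m = multiplicity p n"
    obtain y where y: "n = p ^ m * y" "\<not> p dvd y"
      unfolding m_def
      by (metis less.prems multiplicity_decompose' not_prime_unit p(1) less_numeral_extra(3))
    have "0 < m" unfolding m_def using p less.prems
      by (metis multiplicity_eq_zero_iff not_gr_zero not_prime_unit)
    have "0 < y" using y less.prems by (metis gr0I dvd_0_right)
    have "1 < p ^ m" using prime_gt_1_nat[OF p(1)] \<open>0 < m\<close> by (rule one_less_power)
    then have "y < n" using y \<open>0 < y\<close> by simp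
    have "coprime (p ^ m) y" using p(1) y(2) by (simp add: prime_imp_coprime coprime_power_left_iff)
    then show ?thesis
      using y(1) \<open>0 < y\<close> prime_gt_0_nat[OF p(1)] \<open>0 < m\<close> p(1) less.IH[OF \<open>y < n\<close> \<open>0 < y\<close>] prime_pow
        multiplicativeD_mult[OF assms(1), of "p ^ m" y] multiplicativeD_mult[OF assms(2), of "p ^ m" y]
      by simp
  qed
qed

lemma sum_divisors_prime_power:
  fixes p :: nat
  assumes "prime p"
  shows "(\<Sum>d | d dvd p ^ m. f d) = (\<Sum>i\<le>m. f (p ^ i))"
proof -
  have "{d. d dvd p ^ m} = (\<lambda>i. p ^ i) ` {..m}"
    using divides_primepow_nat[OF assms] by auto
  moreover have "inj_on (\<lambda>i. p ^ i) {..m}"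
    using prime_gt_1_nat[OF assms] by (auto intro!: inj_onI)
  ultimately show ?thesis by (simp add: sum.reindex)
qed

text \<open>
  Multiplicative functions whose value at \<open>p ^ m\<close> depends on \<open>m\<close> alone can be specified by their
  values on exponents.
\<close>
definition from_exponents :: "(nat \<Rightarrow> 'a::comm_semiring_1) \<Rightarrow> nat \<Rightarrow> 'a" where
  "from_exponents g n = (\<Prod>p\<in>prime_factors n. g (multiplicity p n))"

lemma multiplicative_from_exponents: "multiplicative (from_exponents g)"
  unfolding multiplicative_def
proof (intro conjI allI impI)
  show "from_exponents g 1 = 1" by (simp add: from_exponents_def)
next
  fix m n :: nat
  assume pos: "0 < m" "0 < n" and cop: "coprime m n"
  have "p \<notin> prime_factors n" if "p \<in> prime_factors m" for p
    using that cop by (meson coprime_common_divisor in_prime_factors_iff not_prime_unit)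
  then have disj: "prime_factors m \<inter> prime_factors n = {}" by auto
  have mm: "multiplicity p (m * n) = multiplicity p m" if "p \<in> prime_factors m" for p
  proof -
    have "\<not> p dvd n" using that disj pos by (auto simp: in_prime_factors_iff)
    then show ?thesis using that pos
      by (subst prime_elem_multiplicity_mult_distrib) (auto simp: not_dvd_imp_multiplicity_0)
  qed
  have mn: "multiplicity p (m * n) = multiplicity p n" if "p \<in> prime_factors n" for p
  proof -
    have "\<not> p dvd m" using that disj pos by (auto simp: in_prime_factors_iff)
    then show ?thesis using that pos
      by (subst prime_elem_multiplicity_mult_distrib) (auto simp: not_dvd_imp_multiplicity_0)
  qed
  have "prime_factors (m * n) = prime_factors m \<union> prime_factors n"
    using pos by (intro prime_factors_product) auto
  then show "from_exponents g (m * n) = from_exponents g m * from_exponents g n"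
    unfolding from_exponents_def using disj mm mn
    by (simp add: prod.union_disjoint)
qed

lemma from_exponents_prime_power:
  assumes "prime p" "g 0 = 1"
  shows "from_exponents g (p ^ m) = g m"
proof (cases "m = 0")
  case True
  then show ?thesis using assms by (simp add: from_exponents_def)
next
  case False
  then have "prime_factors (p ^ m) = {p}"
    using assms(1) by (simp add: prime_factors_power prime_prime_factors)
  then show ?thesis
    using assms(1) by (simp add: from_exponents_def)
qed

section \<open>The divisor ratio as a divisor sum\<close>

lemma piltz_divisor_0: "piltz_divisor 0 n = (if n = 1 then 1 else 0)"
proof -
  have "{ns :: nat list. length ns = 0 \<and> (\<forall>m\<in>set ns. 0 < m) \<and> prod_list ns = n} = 
      (if n = 1 then {[]} else {})" by auto
  then show ?thesis by (simp add: piltz_divisor_def)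
qed

lemma finite_factorisations:
  assumes "0 < n"
  shows "finite {ns :: nat list. length ns = k \<and> (\<forall>m\<in>set ns. 0 < m) \<and> prod_list ns = n}"
proof (rule finite_subset)
  have "m dvd prod_list ns" if "m \<in> set ns" for m and ns :: "nat list"
    using that by (induction ns) auto
  then show "{ns :: nat list. length ns = k \<and> (\<forall>m\<in>set ns. 0 < m) \<and> prod_list ns = n}
      \<subseteq> {ns. set ns \<subseteq> {..n} \<and> length ns = k}"
    using assms by (auto intro: dvd_imp_le)
  show "finite {ns. set ns \<subseteq> {..n} \<and> length ns = k}"
    by (rule finite_lists_length_eq) simp
qed

text \<open>
  The first entry of a factorisation of \<open>n\<close> is determined by the product \<open>d\<close> of the others, so
  increasing \<open>k\<close> by one amounts to convolving with the constant function 1. Multiplicativity and the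
  values at prime powers follow by induction on \<open>k\<close>.
\<close>
lemma piltz_divisor_Suc:
  assumes "0 < n"
  shows "piltz_divisor (Suc k) n = (\<Sum>d | d dvd n. piltz_divisor k d)"
proof -
  define T where
    "T k n = {ns :: nat list. length ns = k \<and> (\<forall>m\<in>set ns. 0 < m) \<and> prod_list ns = n}" for k n
  have "T (Suc k) n = (\<Union>d\<in>{d. d dvd n}. Cons (n div d) ` T k d)"
  proof (intro equalityI subsetI)
    fix ns assume "ns \<in> T (Suc k) n"
    then obtain m ms where ms: "ns = m # ms" "length ms = k" "\<forall>j\<in>set ms. 0 < j" "m * prod_list ms = n"
      unfolding T_def by (auto simp: length_Suc_conv)
    then have "0 < prod_list ms" using assms by (auto intro: Nat.gr0I)
    then have "prod_list ms dvd n" "m = n div prod_list ms" "ms \<in> T k (prod_list ms)"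
      using ms by (auto simp: T_def)
    then show "ns \<in> (\<Union>d\<in>{d. d dvd n}. Cons (n div d) ` T k d)" using ms(1) by blast
  next
    fix ns assume "ns \<in> (\<Union>d\<in>{d. d dvd n}. Cons (n div d) ` T k d)"
    then obtain d ms where "d dvd n" "ms \<in> T k d" "ns = (n div d) # ms" by auto
    then show "ns \<in> T (Suc k) n"
      using assms by (auto simp: T_def dvd_div_eq_0_iff intro!: Nat.gr0I)
  qed
  then have "card (T (Suc k) n) = card (\<Union>d\<in>{d. d dvd n}. Cons (n div d) ` T k d)" by simp
  also have "\<dots> = (\<Sum>d | d dvd n. card (Cons (n div d) ` T k d))"
  proof (rule card_UN_disjoint)
    show "finite {d. d dvd n}" using assms by simp
    show "\<forall>d\<in>{d. d dvd n}. finite (Cons (n div d) ` T k d)"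
      using assms finite_factorisations by (auto simp: T_def intro!: finite_imageI dvd_pos_nat)
    show "\<forall>d\<in>{d. d dvd n}. \<forall>e\<in>{d. d dvd n}. d \<noteq> e \<longrightarrow>
            Cons (n div d) ` T k d \<inter> Cons (n div e) ` T k e = {}"
      by (auto simp: T_def)
  qed
  also have "\<dots> = (\<Sum>d | d dvd n. card (T k d))"
    by (intro sum.cong refl card_image) (auto intro: inj_onI)
  finally show ?thesis unfolding T_def piltz_divisor_def .
qed

lemma multiplicative_cong:
  assumes "multiplicative f" "\<And>n. 0 < n \<Longrightarrow> g n = f n"
  shows "multiplicative g"
  using assms by (simp add: multiplicative_def)

lemma multiplicative_piltz_divisor: "multiplicative (piltz_divisor k)"
proof (induction k)
  case 0
  then show ?case by (simp add: multiplicative_def piltz_divisor_0)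
next
  case (Suc k)
  show ?case
    using multiplicative_divisor_sum[OF Suc] by (rule multiplicative_cong) (rule piltz_divisor_Suc)
qed

lemma piltz_divisor_prime_power:
  assumes "prime p"
  shows "piltz_divisor (Suc k) (p ^ m) = (k + m) choose m"
proof (induction k arbitrary: m)
  have p: "0 < p ^ j" for j using prime_gt_0_nat[OF assms] by simp
  {
    case 0
    have "(\<Sum>i\<le>m. piltz_divisor 0 (p ^ i)) = (\<Sum>i\<le>m. if i = 0 then 1 else 0)"
      using prime_gt_1_nat[OF assms] by (intro sum.cong) (auto simp: piltz_divisor_0)
    then show ?case
      by (simp add: piltz_divisor_Suc[OF p] sum_divisors_prime_power[OF assms])
  next
    case (Suc k)
    have "piltz_divisor (Suc (Suc k)) (p ^ m) = (\<Sum>i\<le>m. (k + i) choose i)"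
      by (subst piltz_divisor_Suc[OF p])
         (simp only: sum_divisors_prime_power[OF assms] Suc.IH)
    then show ?case by (simp only: sum_choose_lower) simp
  }
qed

lemma multiplicative_D_ratio: "multiplicative (D_ratio k)"
  unfolding multiplicative_def
proof (intro conjI allI impI)
  show "D_ratio k 1 = 1"
    using multiplicativeD_1[OF multiplicative_piltz_divisor[of k]]
    by (simp add: D_ratio_def piltz_divisor_star_def distinct_prime_count_def)
next
  fix m n :: nat
  assume pos: "0 < m" "0 < n" and cop: "coprime m n"
  have "prime_factors m \<inter> prime_factors n = {}"
    using cop by (meson coprime_common_divisor disjoint_iff in_prime_factors_iff not_prime_unit)
  then have "distinct_prime_count (m * n) = distinct_prime_count m + distinct_prime_count n"
    using pos by (simp add: distinct_prime_count_def prime_factors_product card_Un_disjoint)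
  then show "D_ratio k (m * n) = D_ratio k m * D_ratio k n"
    using multiplicativeD_mult[OF multiplicative_piltz_divisor pos cop, of k]
    by (simp add: D_ratio_def piltz_divisor_star_def power_add)
qed

text \<open>
  The value of \<open>D_ratio k\<close> at \<open>p ^ m\<close>. The factor \<open>1 / k\<close> is absent at \<open>m = 0\<close>, because 1 has no
  prime divisor.
\<close>
definition local_D :: "nat \<Rightarrow> nat \<Rightarrow> real" where
  "local_D k m = (if m = 0 then 1 else real ((k + m - 1) choose m) / real k)"

lemma D_ratio_prime_power:
  assumes "prime p" "0 < k"
  shows "D_ratio k (p ^ m) = local_D k m"
proof (cases "m = 0")
  case True
  then show ?thesis
    using multiplicativeD_1[OF multiplicative_D_ratio[of k]] by (simp add: local_D_def)
next
  case False
  then have "distinct_prime_count (p ^ m) = 1"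
    using assms(1) by (simp add: distinct_prime_count_def prime_factors_power prime_prime_factors)
  moreover obtain j where "k = Suc j" using assms(2) by (cases k) auto
  ultimately show ?thesis
    using False assms(1)
    by (simp add: D_ratio_def piltz_divisor_star_def local_D_def piltz_divisor_prime_power)
qed

lemma local_D_mono:
  assumes "0 < k"
  shows "local_D k m \<le> local_D k (Suc m)"
proof (cases "m = 0")
  case True
  then show ?thesis using assms by (simp add: local_D_def)
next
  case False
  obtain j where j: "k = Suc j" using assms by (cases k) auto
  have "(j + m) choose m \<le> (j + Suc m) choose Suc m"
    by simp
  then show ?thesis using False j by (simp add: local_D_def divide_right_mono del: binomial_Suc_Suc)
qed

definition local_increment :: "nat \<Rightarrow> nat \<Rightarrow> real" where
  "local_increment k m = (if m = 0 then 1 else local_D k m - local_D k (m - 1))"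

lemma local_increment_nonneg: "0 < k \<Longrightarrow> 0 \<le> local_increment k m"
  using local_D_mono[of k "m - 1"] by (cases m) (simp_all add: local_increment_def)

lemma sum_local_increment: "(\<Sum>i\<le>m. local_increment k i) = local_D k m"
  by (induction m) (auto simp: local_increment_def local_D_def[of k 0])

text \<open>
  The convolution of \<open>D_ratio k\<close> with the Moebius function: at a prime power this convolution
  is the difference of two consecutive values.
\<close>
definition D_moebius :: "nat \<Rightarrow> nat \<Rightarrow> real" where
  "D_moebius k = from_exponents (local_increment k)"

lemma multiplicative_D_moebius: "multiplicative (D_moebius k)"
  unfolding D_moebius_def by (rule multiplicative_from_exponents)

lemma D_moebius_prime_power: "prime p \<Longrightarrow> D_moebius k (p ^ m) = local_increment k m"
  unfolding D_moebius_def by (rule from_exponents_prime_power) (simp_all add: local_increment_def)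

text \<open>
  Nonnegativity comes from the monotonicity of \<open>local_D k\<close>.
\<close>
lemma D_moebius_nonneg: "0 < k \<Longrightarrow> 0 \<le> D_moebius k n"
  unfolding D_moebius_def from_exponents_def by (intro prod_nonneg) (simp add: local_increment_nonneg)

text \<open>
  Both sides are multiplicative, and at a prime power the divisor sum telescopes.
\<close>
lemma D_ratio_eq_divisor_sum:
  assumes "0 < k" "0 < n"
  shows "D_ratio k n = (\<Sum>d | d dvd n. D_moebius k d)"
proof (rule multiplicative_eqI[OF multiplicative_D_ratio _ _ assms(2)])
  show "multiplicative (\<lambda>n. \<Sum>d | d dvd n. D_moebius k d)"
    by (rule multiplicative_divisor_sum[OF multiplicative_D_moebius])
  show "D_ratio k (p ^ m) = (\<Sum>d | d dvd p ^ m. D_moebius k d)" if "prime p" for p m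
    using that assms(1)
    by (simp add: sum_divisors_prime_power D_moebius_prime_power sum_local_increment D_ratio_prime_power)
qed

text \<open>
  This is the negative binomial series, scaled by \<open>1 / k\<close> and corrected in its constant term.
\<close>
lemma local_D_gf:
  assumes "0 < k" "\<bar>z\<bar> < 1"
  shows "(\<lambda>m. local_D k m * z ^ m) sums (1 - 1 / real k + 1 / real k * (1 - z) powi (- int k))"
proof -
  have "(\<lambda>m. ((- real k) gchoose m) * (- z) ^ m) sums (1 + - z) powr (- real k)"
    using assms(2) by (intro gen_binomial_real) simp
  moreover have "((- real k) gchoose m) * (- z) ^ m = real ((k + m - 1) choose m) * z ^ m" for m
  proof -
    have "real k + real m - 1 = real (k + m - 1)" using assms(1) by (simp add: of_nat_diff)
    then have "((- real k) gchoose m) = (- 1) ^ m * real ((k + m - 1) choose m)"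
      by (simp only: gbinomial_minus binomial_gbinomial)
    moreover have "(- z) ^ m = (- 1) ^ m * z ^ m" by (rule power_minus)
    moreover have "(- 1 :: real) ^ m * (- 1) ^ m = 1" by (simp flip: power_mult_distrib)
    ultimately show ?thesis by (simp add: mult_ac)
  qed
  moreover have "(1 + - z) powr (- real k) = (1 - z) powi (- int k)"
    using assms(2) by (simp add: powr_minus powr_realpow power_int_minus)
  ultimately have "(\<lambda>m. real ((k + m - 1) choose m) * z ^ m) sums (1 - z) powi (- int k)" by simp
  then have "(\<lambda>m. 1 / real k * (real ((k + m - 1) choose m) * z ^ m)) sums (1 / real k * (1 - z) powi (- int k))"
    by (rule sums_mult)
  moreover have "(\<lambda>m. if m = 0 then 1 - 1 / real k else 0) sums (1 - 1 / real k)"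
    using sums_single[of 0 "\<lambda>_. 1 - 1 / real k"] by simp
  ultimately have "(\<lambda>m. (if m = 0 then 1 - 1 / real k else 0) + 1 / real k * (real ((k + m - 1) choose m) * z ^ m))
      sums (1 - 1 / real k + 1 / real k * (1 - z) powi (- int k))"
    by (intro sums_add)
  then show ?thesis
    by (rule sums_cong[THEN iffD1, rotated]) (auto simp: local_D_def)
qed

text \<open>
  Taking differences of consecutive coefficients multiplies the generating function by \<open>1 - z\<close>.
\<close>
lemma local_increment_gf:
  assumes "0 < k" "\<bar>z\<bar> < 1"
  shows "(\<lambda>m. local_increment k m * z ^ m) sums
           ((1 - z) * (1 - 1 / real k + 1 / real k * (1 - z) powi (- int k)))"
proof -
  define S where "S = 1 - 1 / real k + 1 / real k * (1 - z) powi (- int k)"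
  have S: "(\<lambda>m. local_D k m * z ^ m) sums S"
    unfolding S_def by (rule local_D_gf[OF assms])
  have "(\<lambda>m. local_D k m * z ^ Suc m) sums (z * S)"
    using sums_mult[OF S, of z] by (simp add: mult_ac)
  then have "(\<lambda>m. if m = 0 then 0 else local_D k (m - 1) * z ^ m) sums (z * S)"
    using sums_Suc_imp[of "\<lambda>m. if m = 0 then 0 else local_D k (m - 1) * z ^ m" "z * S"] by simp
  from sums_diff[OF S this]
  have "(\<lambda>m. local_D k m * z ^ m - (if m = 0 then 0 else local_D k (m - 1) * z ^ m)) sums ((1 - z) * S)"
    by (simp add: algebra_simps)
  then show ?thesis unfolding S_def[symmetric]
    by (rule sums_cong[THEN iffD1, rotated])
       (auto simp: local_increment_def local_D_def[of k 0] algebra_simps)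
qed

section \<open>Euler products of nonnegative multiplicative functions\<close>

definition numbers_over :: "nat set \<Rightarrow> nat set" where
  "numbers_over P = {n. 0 < n \<and> prime_factors n \<subseteq> P}"

lemma numbers_over_empty: "numbers_over {} = {1}"
proof -
  have "n = 1" if "0 < n" "prime_factors n = {}" for n :: nat
    using that prime_factorization_empty_iff[of n] by auto
  then show ?thesis by (auto simp: numbers_over_def)
qed

text \<open>
  The inductive step of the Euler product for finitely many primes: adjoining a prime \<open>p\<close> adds a
  free exponent of \<open>p\<close>.
\<close>
lemma bij_betw_numbers_over_insert:
  assumes p: "prime p" "p \<notin> P"
  shows "bij_betw (\<lambda>(n, m). p ^ m * n) (numbers_over P \<times> UNIV) (numbers_over (insert p P))"
proof -
  have ndvd: "\<not> p dvd n" if "n \<in> numbers_over P" for n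
    using that p by (auto simp: numbers_over_def in_prime_factors_iff)
  have mult: "multiplicity p (p ^ m * n) = m" if "n \<in> numbers_over P" for m n
    using ndvd[OF that] p(1) by (intro multiplicity_decomposeI) auto
  show ?thesis
    unfolding bij_betw_def
  proof
    show "inj_on (\<lambda>(n, m). p ^ m * n) (numbers_over P \<times> UNIV)"
    proof (rule inj_onI, clarify)
      fix n m n' m' assume n: "n \<in> numbers_over P" "n' \<in> numbers_over P" and eq: "p ^ m * n = p ^ m' * n'"
      then have "m = m'" using mult by metis
      then show "n = n' \<and> m = m'" using eq p(1) by (auto dest: prime_gt_0_nat)
    qed
    show "(\<lambda>(n, m). p ^ m * n) ` (numbers_over P \<times> UNIV) = numbers_over (insert p P)"
    proof (intro equalityI subsetI)
      fix x assume "x \<in> (\<lambda>(n, m). p ^ m * n) ` (numbers_over P \<times> UNIV)"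
      then obtain n m where nm: "x = p ^ m * n" "n \<in> numbers_over P" by auto
      have "prime_factors (p ^ m) \<subseteq> {p}"
        using p(1) by (cases "m = 0") (auto simp: prime_factors_power prime_prime_factors)
      then show "x \<in> numbers_over (insert p P)"
        using nm p(1) by (auto simp: numbers_over_def prime_factors_product prime_gt_0_nat)
    next
      fix x assume x: "x \<in> numbers_over (insert p P)"
      obtain y where y: "x = p ^ multiplicity p x * y" "\<not> p dvd y"
        using x p(1) by (metis (mono_tags, lifting) mem_Collect_eq multiplicity_decompose' not_prime_unit
            numbers_over_def less_numeral_extra(3))
      have "0 < y" using y(2) by (auto intro: Nat.gr0I)
      moreover have "prime_factors y \<subseteq> prime_factors x - {p}"
        using y x by (auto simp: numbers_over_def in_prime_factors_iff) (metis dvd_mult)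
      ultimately have "y \<in> numbers_over P" using x by (auto simp: numbers_over_def)
      then show "x \<in> (\<lambda>(n, m). p ^ m * n) ` (numbers_over P \<times> UNIV)"
        using y(1) by (auto intro!: image_eqI[of _ _ "(y, multiplicity p x)"])
    qed
  qed
qed

lemma has_sum_euler_product_finite:
  fixes f :: "nat \<Rightarrow> real"
  assumes f: "multiplicative f" "\<And>n. 0 \<le> f n"
    and "finite P" "\<And>p. p \<in> P \<Longrightarrow> prime p" "\<And>p. p \<in> P \<Longrightarrow> summable (\<lambda>m. f (p ^ m))"
  shows "(f has_sum (\<Prod>p\<in>P. \<Sum>m. f (p ^ m))) (numbers_over P)"
  using assms(3-)
proof (induction P rule: finite_induct)
  case empty
  then show ?case using multiplicativeD_1[OF f(1)] by (simp add: numbers_over_empty has_sum_finite_iff)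
next
  case (insert p P)
  have p: "prime p" and sm: "summable (\<lambda>m. f (p ^ m))" using insert.prems by auto
  define S where "S = (\<Prod>p\<in>P. \<Sum>m. f (p ^ m))"
  define L where "L = (\<Sum>m. f (p ^ m))"
  have IH: "(f has_sum S) (numbers_over P)" unfolding S_def using insert by auto
  have L: "((\<lambda>m. f (p ^ m)) has_sum L) UNIV"
    unfolding L_def using sm f(2) by (intro sums_nonneg_imp_has_sum summable_sums) auto
  have eq: "f (p ^ m * n) = f n * f (p ^ m)" if "n \<in> numbers_over P" for n m
  proof -
    have "0 < n" "\<not> p dvd n"
      using that p insert.hyps by (auto simp: numbers_over_def in_prime_factors_iff)
    then show ?thesis
      using multiplicativeD_mult[OF f(1), of "p ^ m" n] p
      by (simp add: prime_imp_coprime coprime_power_left_iff prime_gt_0_nat mult.commute)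
  qed
  have row: "((\<lambda>m. case (n, m) of (n, m) \<Rightarrow> f (p ^ m * n)) has_sum f n * L) UNIV"
    if "n \<in> numbers_over P" for n
    using has_sum_cmult_right[OF L, of "f n"] by (simp add: eq[OF that])
  have col: "((\<lambda>n. f n * L) has_sum S * L) (numbers_over P)"
    by (rule has_sum_cmult_left[OF IH])
  have "((\<lambda>(n, m). f (p ^ m * n)) has_sum (S * L)) (numbers_over P \<times> UNIV)"
  proof (rule has_sum_SigmaI[OF row col])
    show "(\<lambda>(n, m). f (p ^ m * n)) summable_on numbers_over P \<times> UNIV"
      by (rule summable_on_SigmaI[OF row]) (use col f(2) in \<open>auto intro: has_sum_imp_summable\<close>)
  qed
  then have "((\<lambda>nm. f (case nm of (n, m) \<Rightarrow> p ^ m * n)) has_sum (S * L)) (numbers_over P \<times> UNIV)"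
    by (simp add: case_prod_unfold)
  then have "(f has_sum (S * L)) (numbers_over (insert p P))"
    by (subst (asm) has_sum_reindex_bij_betw[OF bij_betw_numbers_over_insert[OF p insert.hyps(2)]])
  then show ?case
    using insert.hyps by (simp add: S_def L_def mult.commute)
qed

lemma prime_factors_le: "p \<in> prime_factors n \<Longrightarrow> p \<le> n" for n :: nat
  by (cases "n = 0") (auto simp: in_prime_factors_iff intro: dvd_imp_le)

text \<open>
  A finite set of integers involves finitely many primes, so its partial sum is at most a finite
  Euler product, which the inequality \<open>1 + u \<le> exp u\<close> bounds uniformly.
\<close>
lemma summable_on_multiplicative:
  fixes f :: "nat \<Rightarrow> real"
  assumes f: "multiplicative f" "\<And>n. 0 \<le> f n"
    and local_summable: "\<And>p. prime p \<Longrightarrow> summable (\<lambda>m. f (p ^ m))"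
    and local_bound: "\<And>p. prime p \<Longrightarrow> (\<Sum>m. f (p ^ m)) \<le> 1 + u p"
    and u: "summable u" "\<And>n. 0 \<le> u n"
  shows "f summable_on {0<..}"
proof (rule nonneg_bdd_above_summable_on)
  show "bdd_above (sum f ` {F. F \<subseteq> {0<..} \<and> finite F})"
  proof (rule bdd_aboveI2)
    fix F :: "nat set" assume "F \<in> {F. F \<subseteq> {0<..} \<and> finite F}"
    then have F: "F \<subseteq> {0<..}" "finite F" by auto
    \<comment> \<open>The inserted 0 only keeps the maximum meaningful for empty \<open>F\<close>.\<close>
    define P where "P = {p. prime p \<and> p \<le> Max (insert 0 F)}"
    have P: "finite P" "\<And>p. p \<in> P \<Longrightarrow> prime p" by (auto simp: P_def)
    have "F \<subseteq> numbers_over P"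
    proof
      fix n assume n: "n \<in> F"
      then have "n \<le> Max (insert 0 F)" using F(2) by (intro Max_ge) auto
      then show "n \<in> numbers_over P"
        using n F(1) by (auto simp: numbers_over_def P_def dest: prime_factors_le order.trans)
    qed
    then have "sum f F \<le> (\<Prod>p\<in>P. \<Sum>m. f (p ^ m))"
      using P local_summable f F(2)
      by (intro finite_sum_le_has_sum[OF has_sum_euler_product_finite]) auto
    also have "\<dots> \<le> (\<Prod>p\<in>P. 1 + u p)"
      using P local_bound local_summable f(2) by (intro prod_mono conjI suminf_nonneg) auto
    also have "\<dots> \<le> exp (sum u P)"
      by (rule prod_le_exp_sum) (rule u(2))
    also have "\<dots> \<le> exp (suminf u)"
      using sum_le_suminf[OF u(1) P(1)] u(2) by simp
    finally show "sum f F \<le> exp (suminf u)" .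
  qed
qed (rule f(2))

text \<open>
  The partial products are the sums over the numbers whose primes lie in \<open>Q\<close> and are at most \<open>N\<close>.
  These sums increase with \<open>N\<close>, and eventually they include any given finite part of the full sum.
\<close>
lemma euler_product_tendsto:
  fixes f :: "nat \<Rightarrow> real"
  assumes f: "multiplicative f" "\<And>n. 0 \<le> f n" "f summable_on {0<..}"
    and Q: "\<And>p. p \<in> Q \<Longrightarrow> prime p"
  shows "(\<lambda>N. \<Prod>p\<in>Q \<inter> {..N}. \<Sum>m. f (p ^ m)) \<longlonglongrightarrow> infsum f (numbers_over Q)"
proof -
  have sub: "numbers_over R \<subseteq> {0<..}" for R by (auto simp: numbers_over_def)
  have sm: "f summable_on numbers_over R" for R
    by (rule summable_on_subset[OF f(3) sub])
  have local_summable: "summable (\<lambda>m. f (p ^ m))" if "prime p" for p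
  proof -
    have "f summable_on range (\<lambda>m. p ^ m)"
      by (rule summable_on_subset[OF f(3)]) (use that in \<open>auto simp: prime_gt_0_nat\<close>)
    moreover have "inj (\<lambda>m. p ^ m)"
      using prime_gt_1_nat[OF that] by (auto intro!: injI)
    ultimately show ?thesis
      by (subst (asm) summable_on_reindex) (auto intro: summable_on_imp_summable simp: o_def)
  qed
  have euler: "(f has_sum (\<Prod>p\<in>Q \<inter> {..N}. \<Sum>m. f (p ^ m))) (numbers_over (Q \<inter> {..N}))" for N
    using Q local_summable f by (intro has_sum_euler_product_finite) auto
  show ?thesis
  proof (rule LIMSEQ_I)
    fix e :: real assume "e > 0"
    then obtain F where F: "finite F" "F \<subseteq> numbers_over Q" "dist (sum f F) (infsum f (numbers_over Q)) \<le> e / 2"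
      using infsum_finite_approximation[OF sm[of Q], of "e / 2"] by auto
    have "norm ((\<Prod>p\<in>Q \<inter> {..N}. \<Sum>m. f (p ^ m)) - infsum f (numbers_over Q)) < e" if N: "N \<ge> Max (insert 0 F)" for N
    proof -
      have "F \<subseteq> numbers_over (Q \<inter> {..N})"
      proof
        fix n assume n: "n \<in> F"
        then have "n \<le> N" using F(1) N by (auto dest: Max_ge)
        then show "n \<in> numbers_over (Q \<inter> {..N})"
          using n F(2) by (auto simp: numbers_over_def dest: prime_factors_le)
      qed
      then have "sum f F \<le> (\<Prod>p\<in>Q \<inter> {..N}. \<Sum>m. f (p ^ m))"
        using F(1) f(2) by (intro finite_sum_le_has_sum[OF euler]) auto
      moreover have "(\<Prod>p\<in>Q \<inter> {..N}. \<Sum>m. f (p ^ m)) \<le> infsum f (numbers_over Q)"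
        by (rule has_sum_mono2[OF euler has_sum_infsum[OF sm]]) (use f(2) in \<open>auto simp: numbers_over_def\<close>)
      ultimately show ?thesis using F(3) \<open>e > 0\<close> by (auto simp: dist_real_def)
    qed
    then show "\<exists>no. \<forall>n\<ge>no. norm ((\<Prod>p\<in>Q \<inter> {..n}. \<Sum>m. f (p ^ m)) - infsum f (numbers_over Q)) < e"
      by blast
  qed
qed

section \<open>The main term as an Euler product\<close>

text \<open>
  The linear coefficient of the local series vanishes, because \<open>D_ratio k p = 1\<close>; hence the series
  at \<open>z = p powr -s\<close> exceeds 1 by a multiple of \<open>z^2\<close>. The multiple is uniform in \<open>p\<close> because \<open>z\<close>
  is largest for \<open>p = 2\<close>.
\<close>
lemma local_increment_series_bound:
  assumes "0 < k" "0 < s"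
  obtains B where "0 \<le> B"
    "\<And>p. prime p \<Longrightarrow> summable (\<lambda>m. local_increment k m * (real p powr - s) ^ m)"
    "\<And>p. prime p \<Longrightarrow> (\<Sum>m. local_increment k m * (real p powr - s) ^ m) \<le> 1 + B * real p powr (- 2 * s)"
proof
  define r where "r = (2::real) powr - s"
  have r: "0 < r" "r < 1" using assms(2) by (auto simp: r_def powr_minus powr_less_one field_simps)
  define B where "B = (\<Sum>m. local_increment k (m + 2) * r ^ m)"
  have summable_gf: "summable (\<lambda>m. local_increment k m * z ^ m)" if "\<bar>z\<bar> < 1" for z
    using local_increment_gf[OF assms(1) that] by (rule sums_summable)
  have summable_gf2: "summable (\<lambda>m. local_increment k (m + 2) * z ^ m)" if "0 < z" "z < 1" for z
  proof -
    have "summable (\<lambda>m. local_increment k (m + 2) * z ^ (m + 2))"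
      using summable_gf[of z] that by (subst summable_iff_shift) auto
    then have "summable (\<lambda>m. local_increment k (m + 2) * z ^ (m + 2) * (1 / z ^ 2))"
      by (rule summable_mult2)
    then show ?thesis using that by (simp add: power_add field_simps power2_eq_square)
  qed
  note nonneg = local_increment_nonneg[OF assms(1)]
  show "0 \<le> B" unfolding B_def
    using summable_gf2[OF r] r nonneg by (intro suminf_nonneg) auto
  fix p :: nat assume p: "prime p"
  define z where "z = real p powr - s"
  have p2: "2 \<le> real p" using prime_ge_2_nat[OF p] by simp
  have z: "0 < z" "z \<le> r"
    using p2 assms(2) by (auto simp: z_def r_def intro: powr_mono2')
  then have z1: "z < 1" "\<bar>z\<bar> < 1" using r by auto
  show "summable (\<lambda>m. local_increment k m * (real p powr - s) ^ m)"
    using summable_gf[OF z1(2)] by (simp add: z_def)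
  have inc: "local_increment k 0 = 1" "local_increment k (Suc 0) = 0"
    using assms(1) by (auto simp: local_increment_def local_D_def)
  have "(\<Sum>m. local_increment k m * z ^ m) =
      (\<Sum>m. local_increment k (m + 2) * z ^ (m + 2)) + (\<Sum>m<2. local_increment k m * z ^ m)"
    by (rule suminf_split_initial_segment[OF summable_gf[OF z1(2)]])
  also have "(\<Sum>m<2. local_increment k m * z ^ m) = 1"
    using inc by (simp add: numeral_2_eq_2)
  also have "(\<Sum>m. local_increment k (m + 2) * z ^ (m + 2)) = (\<Sum>m. local_increment k (m + 2) * z ^ m * z ^ 2)"
    by (simp only: power_add mult_ac)
  also have "\<dots> = (\<Sum>m. local_increment k (m + 2) * z ^ m) * z ^ 2"
    by (rule suminf_mult2[OF summable_gf2[OF z(1) z1(1)], symmetric])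
  also have "\<dots> \<le> B * z ^ 2" unfolding B_def
    using z r nonneg
    by (intro mult_right_mono suminf_le summable_gf2 z1 z mult_left_mono power_mono) auto
  also have "z ^ 2 = real p powr (- 2 * s)"
    using p2 by (simp add: z_def power2_eq_square flip: powr_add)
  finally show "(\<Sum>m. local_increment k m * (real p powr - s) ^ m) \<le> 1 + B * real p powr (- 2 * s)"
    by (simp add: z_def)
qed

lemma multiplicative_D_moebius_powr: "multiplicative (\<lambda>n. D_moebius k n * real n powr - s)"
  using multiplicative_D_moebius[of k]
  by (auto simp: multiplicative_def powr_mult mult_ac)

lemma D_moebius_powr_prime_power:
  assumes "prime p"
  shows "D_moebius k (p ^ m) * real (p ^ m) powr - s = local_increment k m * (real p powr - s) ^ m"
  using prime_gt_0_nat[OF assms]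
  by (simp add: D_moebius_prime_power[OF assms] powr_powr mult.commute flip: powr_realpow)

text \<open>
  The threshold \<open>1/2\<close> is the point where \<open>\<Sum> p powr (-2 * s)\<close>, taken over all integers \<open>p\<close>, starts
  to converge.
\<close>
lemma summable_D_moebius_powr:
  assumes "0 < k" "1 / 2 < s"
  shows "(\<lambda>n. D_moebius k n * real n powr - s) summable_on {0<..}"
proof -
  obtain B where B: "0 \<le> B"
    "\<And>p. prime p \<Longrightarrow> summable (\<lambda>m. local_increment k m * (real p powr - s) ^ m)"
    "\<And>p. prime p \<Longrightarrow> (\<Sum>m. local_increment k m * (real p powr - s) ^ m) \<le> 1 + B * real p powr (- 2 * s)"
    using local_increment_series_bound[OF assms(1), of s] assms(2) by auto
  show ?thesis
  proof (rule summable_on_multiplicative[OF multiplicative_D_moebius_powr])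
    show "summable (\<lambda>p. B * real p powr (- 2 * s))"
      using assms(2) by (intro summable_mult) (simp add: summable_real_powr_iff)
  qed (use B assms(1) in \<open>auto simp: D_moebius_powr_prime_power D_moebius_nonneg simp del: of_nat_power\<close>)
qed

definition euler_factor :: "nat \<Rightarrow> nat \<Rightarrow> real" where
  "euler_factor k p = (1 - 1 / real p) * (1 - 1 / real k + 1 / real k * (1 - 1 / real p) powi (- int k))"

lemma euler_factor_sums:
  assumes "0 < k" "prime p"
  shows "(\<lambda>m. D_moebius k (p ^ m) * real (p ^ m) powr - 1) sums euler_factor k p"
proof -
  have "real p powr - 1 = 1 / real p" using prime_gt_0_nat[OF assms(2)] by (simp add: powr_minus field_simps)
  moreover have "\<bar>1 / real p\<bar> < 1" using prime_gt_1_nat[OF assms(2)] by simp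
  ultimately show ?thesis
    unfolding D_moebius_powr_prime_power[OF assms(2)] euler_factor_def
    using local_increment_gf[OF assms(1), of "1 / real p"] by simp
qed

text \<open>
  The factors are \<open>1 + O(1 / p^2)\<close>, so the infinite product converges, and its value is the limit of
  its partial products.
\<close>
lemma partial_products_tendsto_A_const:
  assumes "0 < k"
  shows "(\<lambda>N. \<Prod>p | prime p \<and> p \<le> N. euler_factor k p) \<longlonglongrightarrow> A_const k"
proof -
  define F where "F = (\<lambda>p. if prime p then euler_factor k p else 1)"
  obtain B where B: "0 \<le> B"
    "\<And>p. prime p \<Longrightarrow> summable (\<lambda>m. local_increment k m * (real p powr - 1) ^ m)"
    "\<And>p. prime p \<Longrightarrow> (\<Sum>m. local_increment k m * (real p powr - 1) ^ m) \<le> 1 + B * real p powr (- 2 * 1)"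
    using local_increment_series_bound[OF assms, of 1] by auto
  have bound: "norm (F p - 1) \<le> B * real p powr - 2" for p
  proof (cases "prime p")
    case True
    have eq: "euler_factor k p = (\<Sum>m. local_increment k m * (real p powr - 1) ^ m)"
      using euler_factor_sums[OF assms True] unfolding D_moebius_powr_prime_power[OF True]
      by (rule sums_unique)
    have "(\<Sum>m\<in>{0}. local_increment k m * (real p powr - 1) ^ m) \<le> euler_factor k p"
      unfolding eq by (rule sum_le_suminf[OF B(2)[OF True]]) (auto simp: local_increment_nonneg assms)
    then show ?thesis
      using B(3)[OF True, folded eq] True by (simp add: F_def local_increment_def)
  next
    case False
    then show ?thesis using B(1) by (simp add: F_def)
  qed
  have "summable (\<lambda>p. B * real p powr - 2)"
    by (intro summable_mult) (simp add: summable_real_powr_iff)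
  then have "summable (\<lambda>p. norm (F p - 1))"
    by (rule summable_comparison_test'[where N = 0]) (use bound in simp)
  then have "convergent_prod F"
    by (intro abs_convergent_prod_imp_convergent_prod) (simp add: abs_convergent_prod_conv_summable)
  then have "(\<lambda>N. \<Prod>p\<le>N. F p) \<longlonglongrightarrow> prodinf F"
    by (rule convergent_prod_LIMSEQ)
  moreover have "prodinf F = A_const k"
    unfolding F_def A_const_def euler_factor_def by (rule refl)
  moreover have "(\<Prod>p\<le>N. F p) = (\<Prod>p | prime p \<and> p \<le> N. euler_factor k p)" for N
    unfolding F_def by (intro prod.mono_neutral_cong_right) auto
  ultimately show ?thesis by simp
qed

lemma coprime_eq_numbers_over:
  assumes "0 < q"
  shows "{d. 0 < d \<and> coprime d q} = numbers_over {p. prime p \<and> \<not> p dvd q}"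
proof -
  have "coprime d q \<longleftrightarrow> (\<forall>p\<in>prime_factors d. \<not> p dvd q)" if "0 < d" for d
  proof
    assume "coprime d q"
    then show "\<forall>p\<in>prime_factors d. \<not> p dvd q"
      by (meson coprime_common_divisor in_prime_factors_iff not_prime_unit)
  next
    assume *: "\<forall>p\<in>prime_factors d. \<not> p dvd q"
    show "coprime d q"
    proof (rule ccontr)
      assume "\<not> coprime d q"
      then obtain p where "prime p" "p dvd gcd d q"
        by (metis coprime_iff_gcd_eq_1 prime_factor_nat)
      then show False using * that by (auto simp: in_prime_factors_iff)
    qed
  qed
  then show ?thesis by (auto simp: numbers_over_def in_prime_factors_iff)
qed

text \<open>
  For \<open>N \<ge> q\<close> the product over all primes up to \<open>N\<close> splits into the primes not dividing \<open>q\<close> and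
  those dividing \<open>q\<close>. In the limit this compares the sum over \<open>d\<close> coprime to \<open>q\<close> with \<open>A_const k\<close>.
  The correction factor in \<open>G_const k q\<close> cancels each Euler factor at a prime dividing \<open>q\<close> except for
  \<open>1 - 1/p\<close>, and these leftovers multiply to \<open>totient q / q\<close>.
\<close>
lemma infsum_D_moebius_coprime:
  assumes "0 < k" "0 < q"
  shows "(\<Sum>\<^sub>\<infinity>d\<in>{d. 0 < d \<and> coprime d q}. D_moebius k d * real d powr - 1) =
           real q * (G_const k q / real (totient q))"
proof -
  define S where "S = (\<Sum>\<^sub>\<infinity>d\<in>{d. 0 < d \<and> coprime d q}. D_moebius k d * real d powr - 1)"
  define Q where "Q = {p. prime p \<and> \<not> p dvd q}"
  have "(\<lambda>N. \<Prod>p\<in>Q \<inter> {..N}. \<Sum>m. D_moebius k (p ^ m) * real (p ^ m) powr - 1) \<longlonglongrightarrow> S"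
    unfolding S_def coprime_eq_numbers_over[OF assms(2)] Q_def
    by (intro euler_product_tendsto multiplicative_D_moebius_powr summable_D_moebius_powr)
       (use assms(1) in \<open>auto simp: D_moebius_nonneg\<close>)
  also have "(\<lambda>N. \<Prod>p\<in>Q \<inter> {..N}. \<Sum>m. D_moebius k (p ^ m) * real (p ^ m) powr - 1) =
      (\<lambda>N. \<Prod>p\<in>Q \<inter> {..N}. euler_factor k p)"
    by (intro ext prod.cong refl sums_unique[symmetric] euler_factor_sums) (auto simp: Q_def assms)
  finally have "(\<lambda>N. (\<Prod>p\<in>Q \<inter> {..N}. euler_factor k p) * (\<Prod>p\<in>prime_factors q. euler_factor k p))
      \<longlonglongrightarrow> S * (\<Prod>p\<in>prime_factors q. euler_factor k p)"
    by (rule tendsto_mult_right)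
  moreover have "\<forall>\<^sub>F N in sequentially.
      (\<Prod>p\<in>Q \<inter> {..N}. euler_factor k p) * (\<Prod>p\<in>prime_factors q. euler_factor k p) =
      (\<Prod>p | prime p \<and> p \<le> N. euler_factor k p)"
    using eventually_ge_at_top[of q]
  proof eventually_elim
    case (elim N)
    have "{p. prime p \<and> p \<le> N} = (Q \<inter> {..N}) \<union> prime_factors q"
      using elim assms(2) by (auto simp: Q_def in_prime_factors_iff intro: order.trans[OF dvd_imp_le])
    moreover have "(Q \<inter> {..N}) \<inter> prime_factors q = {}"
      by (auto simp: Q_def in_prime_factors_iff)
    ultimately show ?case by (simp add: prod.union_disjoint)
  qed
  ultimately have "(\<lambda>N. \<Prod>p | prime p \<and> p \<le> N. euler_factor k p)
      \<longlonglongrightarrow> S * (\<Prod>p\<in>prime_factors q. euler_factor k p)"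
    by (rule Lim_transform_eventually)
  with partial_products_tendsto_A_const[OF assms(1)]
  have A: "A_const k = S * (\<Prod>p\<in>prime_factors q. euler_factor k p)"
    by (rule LIMSEQ_unique)
  have "euler_factor k p * (real k / (real k - 1 + (1 - 1 / real p) powi (- int k))) = 1 - 1 / real p"
    if "p \<in> prime_factors q" for p
  proof -
    have "1 < real p" using that prime_gt_1_nat[of p] by auto
    then have "0 < (1 - 1 / real p) powi (- int k)"
      by (intro zero_less_power_int) simp
    then have "0 < real k - 1 + (1 - 1 / real p) powi (- int k)"
      using assms(1) by linarith
    moreover have "1 - 1 / real k + 1 / real k * w = (real k - 1 + w) / real k" for w
      using assms(1) by (simp add: field_simps)
    ultimately show ?thesis
      using assms(1) by (simp add: euler_factor_def)
  qed
  then have "G_const k q = S * (\<Prod>p\<in>prime_factors q. 1 - 1 / real p)"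
    by (simp add: G_const_def A mult.assoc flip: prod.distrib)
  then have "real q * G_const k q = S * real (totient q)"
    by (simp add: totient_formula2)
  then show ?thesis
    unfolding S_def[symmetric] using assms(2) by (simp add: field_simps)
qed

section \<open>Counting in progressions and the error term\<close>

text \<open>
  The elements of the progression are \<open>r' + j * M\<close> for the representative \<open>r'\<close> of the class in
  \<open>{1..M}\<close>, so their number is \<open>floor ((x - r') / M) + 1\<close>, or 0 if \<open>r' > x\<close>.
\<close>
lemma card_cong_bounds:
  fixes x :: real and M r :: nat
  assumes "0 < M" "0 \<le> x"
  shows "\<bar>real (card {n. 0 < n \<and> real n \<le> x \<and> [n = r] (mod M)}) - x / real M\<bar> \<le> 1"
proof -
  \<comment> \<open>The residue 0 is represented by \<open>M\<close>, since the count starts at 1.\<close>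
  define r' where "r' = (if r mod M = 0 then M else r mod M)"
  have r': "0 < r'" "r' \<le> M" "[r = r'] (mod M)"
    using assms(1) by (auto simp: r'_def cong_def intro: less_imp_le)
  have set_eq: "{n. 0 < n \<and> real n \<le> x \<and> [n = r] (mod M)} =
      (\<lambda>j. r' + j * M) ` {j. real (r' + j * M) \<le> x}" 
  proof (intro equalityI subsetI)
    fix n assume n: "n \<in> {n. 0 < n \<and> real n \<le> x \<and> [n = r] (mod M)}"
    then have cong: "[n = r'] (mod M)" using r'(3) cong_trans by blast
    have "r' \<le> n"
    proof (rule ccontr)
      assume "\<not> r' \<le> n"
      then have "n < M" "n < r'" using r' by auto
      then show False using cong n r'(2) by (auto simp: cong_def r'_def split: if_splits)
    qed
    then obtain j where "n = r' + j * M"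
      using cong by (metis cong_le_nat add.commute mult.commute)
    then show "n \<in> (\<lambda>j. r' + j * M) ` {j. real (r' + j * M) \<le> x}" using n by auto
  next
    fix n assume "n \<in> (\<lambda>j. r' + j * M) ` {j. real (r' + j * M) \<le> x}"
    then obtain j where j: "n = r' + j * M" "real (r' + j * M) \<le> x" by auto
    have "[n = r] (mod M)" using r'(3) unfolding j(1) by (simp add: cong_def)
    then show "n \<in> {n. 0 < n \<and> real n \<le> x \<and> [n = r] (mod M)}"
      using j r'(1) by auto
  qed
  have inj: "inj_on (\<lambda>j. r' + j * M) A" for A using assms(1) by (auto intro!: inj_onI)
  have rM: "0 < real r'" "real r' \<le> real M" "0 < real M" using r' assms(1) by auto
  show ?thesis
  proof (cases "real r' \<le> x")
    case True
    define t where "t = (x - real r') / real M"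
    have t: "0 \<le> t" using True by (simp add: t_def)
    have "{j. real (r' + j * M) \<le> x} = {..nat \<lfloor>t\<rfloor>}"
    proof -
      have "real (r' + j * M) \<le> x \<longleftrightarrow> real j \<le> t" for j
        using rM by (simp add: t_def field_simps)
      moreover have "real j \<le> t \<longleftrightarrow> j \<le> nat \<lfloor>t\<rfloor>" for j
        using t by (simp add: le_nat_iff le_floor_iff)
      ultimately show ?thesis by auto
    qed
    then have "real (card {n. 0 < n \<and> real n \<le> x \<and> [n = r] (mod M)}) = real (nat \<lfloor>t\<rfloor>) + 1"
      by (simp add: set_eq card_image[OF inj])
    moreover have "real (nat \<lfloor>t\<rfloor>) \<le> t" "t < real (nat \<lfloor>t\<rfloor>) + 1"
      using t by linarith+
    moreover have "t = x / real M - real r' / real M" "0 < real r' / real M" "real r' / real M \<le> 1"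
      using rM by (auto simp: t_def diff_divide_distrib)
    ultimately show ?thesis by linarith
  next
    case False
    have "{j. real (r' + j * M) \<le> x} = {}"
    proof -
      have "\<not> real (r' + j * M) \<le> x" for j
      proof -
        have "real r' \<le> real (r' + j * M)" by (simp only: of_nat_le_iff le_add1)
        then show ?thesis using False by linarith
      qed
      then show ?thesis by blast
    qed
    then have "card {n. 0 < n \<and> real n \<le> x \<and> [n = r] (mod M)} = 0" by (simp add: set_eq)
    moreover have "x / real M \<le> 1" using False rM by simp
    ultimately show ?thesis using assms by simp
  qed
qed

text \<open>
  By the Chinese remainder theorem the two conditions select one residue class modulo \<open>d * q\<close>.
\<close>
lemma card_cong_multiples_bounds:
  fixes x :: real
  assumes "0 < q" "0 < d" "coprime d q" "0 \<le> x"
  shows "\<bar>real (card {n. 0 < n \<and> real n \<le> x \<and> [n = a] (mod q) \<and> d dvd n}) - x / (real d * real q)\<bar> \<le> 1"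
proof -
  obtain r where r: "[r = 0] (mod d)" "[r = a] (mod q)"
    using binary_chinese_remainder_nat[OF assms(3)] by blast
  have "[n = a] (mod q) \<and> d dvd n \<longleftrightarrow> [n = r] (mod d * q)" for n
  proof
    assume "[n = a] (mod q) \<and> d dvd n"
    then have "[n = r] (mod q)" "[n = r] (mod d)"
      using r by (auto simp: cong_def)
    then show "[n = r] (mod d * q)" using assms(3) by (intro coprime_cong_mult_nat)
  next
    assume "[n = r] (mod d * q)"
    then have "[n = r] (mod q)" "[n = r] (mod d)"
      by (metis cong_modulus_mult_nat mult.commute)+
    then show "[n = a] (mod q) \<and> d dvd n"
      using r by (auto simp: cong_def)
  qed
  then show ?thesis
    using card_cong_bounds[of "d * q" x r] assms by simp
qed

text \<open>
  All divisors of an integer congruent to \<open>a\<close> are coprime to \<open>q\<close>, so exchanging the order of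
  summation leaves only such \<open>d\<close>.
\<close>
lemma sum_D_ratio_eq_sum_D_moebius:
  fixes a q :: nat and x :: real
  assumes "0 < k" "coprime a q"
  shows "(\<Sum>n | 0 < n \<and> real n \<le> x \<and> [n = a] (mod q). D_ratio k n) =
         (\<Sum>d | 0 < d \<and> real d \<le> x \<and> coprime d q. D_moebius k d *
            real (card {n. 0 < n \<and> real n \<le> x \<and> [n = a] (mod q) \<and> d dvd n}))"
proof -
  define A where "A = {n. 0 < n \<and> real n \<le> x \<and> [n = a] (mod q)}"
  define E where "E = {d. 0 < d \<and> real d \<le> x \<and> coprime d q}"
  have "A \<subseteq> {..nat \<lfloor>x\<rfloor>}" "E \<subseteq> {..nat \<lfloor>x\<rfloor>}"
    by (auto simp: A_def E_def le_nat_floor)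
  then have fin: "finite A" "finite E" by (auto intro: finite_subset)
  have divisors: "{d. d dvd n} = {d \<in> E. d dvd n}" if "n \<in> A" for n
  proof -
    have n: "0 < n" "real n \<le> x" "[n = a] (mod q)" using that by (auto simp: A_def)
    have "coprime n q" using n(3) assms(2) by (metis cong_imp_coprime cong_sym)
    then have "d \<in> E" if "d dvd n" for d
      using that n dvd_imp_le[OF that n(1)] coprime_divisors[OF that dvd_refl[of q]]
      by (auto simp: E_def intro: dvd_pos_nat)
    then show ?thesis by auto
  qed
  have "(\<Sum>n\<in>A. D_ratio k n) = (\<Sum>n\<in>A. \<Sum>d | d dvd n. D_moebius k d)"
    by (rule sum.cong) (auto simp: A_def D_ratio_eq_divisor_sum[OF assms(1)])
  also have "\<dots> = (\<Sum>n\<in>A. \<Sum>d\<in>E. if d dvd n then D_moebius k d else 0)"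
    by (rule sum.cong) (auto simp: divisors sum.inter_filter[OF fin(2)])
  also have "\<dots> = (\<Sum>d\<in>E. \<Sum>n\<in>A. if d dvd n then D_moebius k d else 0)"
    by (rule sum.swap)
  also have "\<dots> = (\<Sum>d\<in>E. D_moebius k d * real (card {n \<in> A. d dvd n}))"
    by (rule sum.cong) (auto simp: mult.commute simp flip: sum.inter_filter[OF fin(1)])
  finally show ?thesis by (simp add: A_def E_def conj_ac)
qed

text \<open>
  The exact sum and the main term are both written as infinite sums over all \<open>d\<close> coprime to \<open>q\<close> and
  compared term by term. Bounding every term by \<open>h(d) (x / d) powr s\<close> treats the counting error
  for \<open>d \<le> x\<close> and the tail of the main term for \<open>d > x\<close> at once.
\<close>
lemma D_ratio_progression_error:
  fixes a q :: nat and x s :: real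
  assumes "0 < k" "0 < q" "coprime a q" "0 < x" "1 / 2 < s" "s \<le> 1"
  shows "\<bar>(\<Sum>n | 0 < n \<and> real n \<le> x \<and> [n = a] (mod q). D_ratio k n)
            - G_const k q / real (totient q) * x\<bar>
         \<le> (\<Sum>\<^sub>\<infinity>d\<in>{0<..}. D_moebius k d * real d powr - s) * x powr s"
proof -
  define h where "h = D_moebius k"
  have h: "0 \<le> h d" for d unfolding h_def by (rule D_moebius_nonneg[OF assms(1)])
  define N where "N = (\<lambda>d. real (card {n. 0 < n \<and> real n \<le> x \<and> [n = a] (mod q) \<and> d dvd n}))"
  define Dq where "Dq = {d. 0 < d \<and> coprime d q}"
  define T where "T = (\<Sum>n | 0 < n \<and> real n \<le> x \<and> [n = a] (mod q). D_ratio k n)"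
  define M where "M = G_const k q / real (totient q) * x"
  define H where "H = (\<Sum>\<^sub>\<infinity>d\<in>{0<..}. h d * real d powr - s)"
  have summable: "(\<lambda>d. h d * real d powr - t) summable_on A" if "1 / 2 < t" "A \<subseteq> {0<..}" for t A
    using summable_on_subset[OF summable_D_moebius_powr[OF assms(1) that(1)] that(2)] by (simp add: h_def)
  have Dq: "Dq \<subseteq> {0<..}" by (auto simp: Dq_def)
  have N_zero: "N d = 0" if "x < real d" for d
  proof -
    have "{n. 0 < n \<and> real n \<le> x \<and> [n = a] (mod q) \<and> d dvd n} = {}"
      using that by (auto dest!: dvd_imp_le)
    then show ?thesis by (simp only: N_def card.empty of_nat_0)
  qed
  have sum_T: "((\<lambda>d. h d * N d) has_sum T) Dq"
  proof (rule has_sum_finite_neutralI)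
    have "{d. 0 < d \<and> real d \<le> x \<and> coprime d q} \<subseteq> {..nat \<lfloor>x\<rfloor>}" by (auto simp: le_nat_floor)
    then show "finite {d. 0 < d \<and> real d \<le> x \<and> coprime d q}" by (rule finite_subset) simp
    show "T = (\<Sum>d | 0 < d \<and> real d \<le> x \<and> coprime d q. h d * N d)"
      unfolding T_def h_def N_def by (rule sum_D_ratio_eq_sum_D_moebius[OF assms(1,3)])
  qed (auto simp: Dq_def N_zero)
  have "((\<lambda>d. h d * real d powr - 1) has_sum (real q * (G_const k q / real (totient q)))) Dq"
    using infsum_D_moebius_coprime[OF assms(1,2)] summable[of 1, OF _ Dq]
    by (simp add: has_sum_iff h_def Dq_def)
  from has_sum_cmult_right[OF this, of "x / real q"]
  have "((\<lambda>d. x / real q * (h d * real d powr - 1)) has_sum M) Dq"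
    using assms(2) by (simp add: M_def mult.commute)
  from has_sum_add[OF sum_T has_sum_cmult_right[OF this, of "- 1"]]
  have diff: "((\<lambda>d. h d * N d - x / real q * (h d * real d powr - 1)) has_sum (T - M)) Dq" by simp
  have bound: "norm (h d * N d - x / real q * (h d * real d powr - 1)) \<le> h d * real d powr - s * x powr s"
    if "d \<in> Dq" for d
  proof -
    have d: "0 < d" "coprime d q" using that by (auto simp: Dq_def)
    have "\<bar>N d - x / (real d * real q)\<bar> \<le> (x / real d) powr s"
    proof (cases "real d \<le> x")
      case True
      have "\<bar>N d - x / (real d * real q)\<bar> \<le> 1"
        unfolding N_def using assms d by (intro card_cong_multiples_bounds) auto
      also have "1 \<le> (x / real d) powr s"
        using True d assms(5) by (intro ge_one_powr_ge_zero) auto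
      finally show ?thesis .
    next
      case False
      then have "\<bar>N d - x / (real d * real q)\<bar> = (x / real d) / real q"
        using assms(4) by (simp add: N_zero)
      also have "\<dots> \<le> x / real d / 1"
        using assms(2,4) by (intro divide_left_mono) auto
      also have "x / real d / 1 = (x / real d) powr 1"
        using assms(4) by simp
      also have "\<dots> \<le> (x / real d) powr s"
        using False assms(4,6) d by (intro powr_mono') auto
      finally show ?thesis .
    qed
    then have "h d * \<bar>N d - x / (real d * real q)\<bar> \<le> h d * (x / real d) powr s"
      using h by (rule mult_left_mono)
    moreover have "h d * N d - x / real q * (h d * real d powr - 1) = h d * (N d - x / (real d * real q))"
      using d by (simp add: powr_minus field_simps)
    moreover have "h d * (x / real d) powr s = h d * real d powr - s * x powr s"
      using d assms(4) by (simp add: powr_divide powr_minus field_simps)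
    ultimately show ?thesis
      by (simp only: real_norm_def abs_mult abs_of_nonneg[OF h])
  qed
  have "((\<lambda>d. h d * real d powr - s * x powr s) has_sum
            ((\<Sum>\<^sub>\<infinity>d\<in>Dq. h d * real d powr - s) * x powr s)) Dq"
    by (intro has_sum_cmult_left has_sum_infsum summable assms(5) Dq)
  from norm_infsum_le[OF diff this bound]
  have "\<bar>T - M\<bar> \<le> (\<Sum>\<^sub>\<infinity>d\<in>Dq. h d * real d powr - s) * x powr s" by simp
  also have "\<dots> \<le> H * x powr s" unfolding H_def
    using h by (intro mult_right_mono infsum_mono2 summable assms(5) Dq) auto
  finally show ?thesis by (simp add: T_def M_def H_def h_def)
qed

theorem theorem3p1:
  fixes k q :: nat and \<delta> K \<epsilon> :: real
  assumes "k \<ge> 2" and "q \<ge> 1" and "\<delta> > 0" and "K > 0" and "\<epsilon> > 0"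
  shows "\<exists>C>0. \<forall>a::nat. 1 \<le> a \<and> a \<le> q \<and> coprime a q \<longrightarrow>
           (\<forall>x::real. x \<ge> 2 \<and> real q \<le> K * x powr \<delta> \<longrightarrow>
             \<bar>(\<Sum>n | 0 < n \<and> real n \<le> x \<and> [n = a] (mod q). D_ratio k n)
                - G_const k q / real (totient q) * x\<bar>
             \<le> C * sqrt (real q) * x powr (1 / 2 + \<epsilon>))"
proof -
  \<comment> \<open>The error bound holds only for exponents up to 1, so large \<open>\<epsilon>\<close> are truncated.\<close>
  define s where "s = min (1 / 2 + \<epsilon>) 1"
  have s: "1 / 2 < s" "s \<le> 1" "s \<le> 1 / 2 + \<epsilon>" using assms(5) by (auto simp: s_def)
  define H where "H = (\<Sum>\<^sub>\<infinity>d\<in>{0<..}. D_moebius k d * real d powr - s)"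
  have "0 \<le> H" unfolding H_def using assms(1) by (intro infsum_nonneg) (simp add: D_moebius_nonneg)
  show ?thesis
  proof (intro exI[of _ "H + 1"] conjI allI impI)
    show "0 < H + 1" using \<open>0 \<le> H\<close> by simp
    fix a :: nat and x :: real
    assume a: "1 \<le> a \<and> a \<le> q \<and> coprime a q" and x: "x \<ge> 2 \<and> real q \<le> K * x powr \<delta>"
    have "\<bar>(\<Sum>n | 0 < n \<and> real n \<le> x \<and> [n = a] (mod q). D_ratio k n)
                - G_const k q / real (totient q) * x\<bar> \<le> H * x powr s"
      unfolding H_def using a x assms(1,2) s by (intro D_ratio_progression_error) auto
    also have "\<dots> \<le> ((H + 1) * sqrt (real q)) * x powr (1 / 2 + \<epsilon>)"
    proof (rule mult_mono)
      have "(H + 1) * 1 \<le> (H + 1) * sqrt (real q)"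
        using \<open>0 \<le> H\<close> assms(2) by (intro mult_left_mono) auto
      then show "H \<le> (H + 1) * sqrt (real q)" by simp
      show "x powr s \<le> x powr (1 / 2 + \<epsilon>)" using x s(3) by (intro powr_mono) auto
    qed (use \<open>0 \<le> H\<close> in auto)
    finally show "\<bar>(\<Sum>n | 0 < n \<and> real n \<le> x \<and> [n = a] (mod q). D_ratio k n)
                - G_const k q / real (totient q) * x\<bar>
             \<le> (H + 1) * sqrt (real q) * x powr (1 / 2 + \<epsilon>)" .
  qed
qed

end
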